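(* Let $K\ge 1$ and let $f$ be a sense-preserving and $K$-quasiregular harmonic mapping on the unit disk $\mathbb{D}$ with $f(\mathbb{D})\subset\mathbb{D}$. Then for all $z\in\mathbb{D}$, $$\Lambda_{f}(z)\leq K\,\frac{1-|f(z)|^{2}}{1-|z|^{2}}\leq\frac{4K}{\pi}\left(\frac{\cos(|f(z)|\pi/2)}{1-|z|^{2}}\right).$$ Moreover, the first inequality is sharp when $K=1$ (that is, for $K=1$ equality is attained by some such $f$ at some $z$).
   Context: $\mathbb{D}=\{z\in\mathbb{C}:|z|<1\}$. For a complex-valued harmonic mapping $f$ on $\mathbb{D}$, put $\Lambda_f=|f_z|+|f_{\overline z}|$ and $\lambda_f=|f_z|-|f_{\overline z}|$, where $f_z,f_{\overline z}$ are the Wirtinger derivatives. $f$ is sense-preserving if its Jacobian $|f_z|^2-|f_{\overline z}|^2$ is positive on $\mathbb{D}$. A sense-preserving harmonic mapping $f:\mathbb{D}\to\mathbb{C}$ is called a $K$-quasiregular harmonic mapping if $\Lambda_f(z)/\lambda_f(z)\le K$ for all $z\in\mathbb{D}$, i.e. $|f_{\overline z}(z)|/|f_z(z)|\le \frac{K-1}{K+1}$ for all $z\in\mathbb{D}$. *)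

theory Defs
  imports "HOL-Analysis.Analysis"
begin

abbreviation unit_disk :: "complex set" where
  "unit_disk \<equiv> ball 0 1"

text \<open>
  The derivatives below are real derivatives on \<open>\<complex>\<close> regarded as a real vector space. They
  are meaningful only at points of real differentiability; \<open>harmonic_on\<close> provides this for \<open>f\<close>
  and for its first partial derivatives.
\<close>

definition partial_x :: "(complex \<Rightarrow> complex) \<Rightarrow> complex \<Rightarrow> complex" where
  "partial_x f z = frechet_derivative f (at z) 1"

definition partial_y :: "(complex \<Rightarrow> complex) \<Rightarrow> complex \<Rightarrow> complex" where
  "partial_y f z = frechet_derivative f (at z) \<i>"

definition C1_on :: "complex set \<Rightarrow> (complex \<Rightarrow> complex) \<Rightarrow> bool" where
  "C1_on S f \<longleftrightarrow> f differentiable_on S \<and>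
     continuous_on S (partial_x f) \<and> continuous_on S (partial_y f)"

definition C2_on :: "complex set \<Rightarrow> (complex \<Rightarrow> complex) \<Rightarrow> bool" where
  "C2_on S f \<longleftrightarrow> C1_on S f \<and> C1_on S (partial_x f) \<and> C1_on S (partial_y f)"

definition harmonic_on :: "complex set \<Rightarrow> (complex \<Rightarrow> complex) \<Rightarrow> bool" where
  "harmonic_on S f \<longleftrightarrow> open S \<and> C2_on S f \<and>
     (\<forall>z\<in>S. partial_x (partial_x f) z + partial_y (partial_y f) z = 0)"

definition wirtinger_z :: "(complex \<Rightarrow> complex) \<Rightarrow> complex \<Rightarrow> complex" where
  "wirtinger_z f z = (partial_x f z - \<i> * partial_y f z) / 2"

definition wirtinger_zbar :: "(complex \<Rightarrow> complex) \<Rightarrow> complex \<Rightarrow> complex" where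
  "wirtinger_zbar f z = (partial_x f z + \<i> * partial_y f z) / 2"

definition Lambda_max :: "(complex \<Rightarrow> complex) \<Rightarrow> complex \<Rightarrow> real" where
  "Lambda_max f z = cmod (wirtinger_z f z) + cmod (wirtinger_zbar f z)"

definition lambda_min :: "(complex \<Rightarrow> complex) \<Rightarrow> complex \<Rightarrow> real" where
  "lambda_min f z = cmod (wirtinger_z f z) - cmod (wirtinger_zbar f z)"

definition jacobian_det :: "(complex \<Rightarrow> complex) \<Rightarrow> complex \<Rightarrow> real" where
  "jacobian_det f z = (cmod (wirtinger_z f z))\<^sup>2 - (cmod (wirtinger_zbar f z))\<^sup>2"

definition sense_preserving_on :: "complex set \<Rightarrow> (complex \<Rightarrow> complex) \<Rightarrow> bool" where
  "sense_preserving_on S f \<longleftrightarrow> (\<forall>z\<in>S. 0 < jacobian_det f z)"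

text \<open>Positivity of the Jacobian makes \<open>lambda_min f z\<close> positive, so the quotient below is never
  a division by zero.\<close>

definition quasiregular_harmonic :: "real \<Rightarrow> (complex \<Rightarrow> complex) \<Rightarrow> bool" where
  "quasiregular_harmonic K f \<longleftrightarrow>
     harmonic_on unit_disk f \<and> sense_preserving_on unit_disk f \<and>
     (\<forall>z\<in>unit_disk. Lambda_max f z / lambda_min f z \<le> K)"

end

theory Submission
  imports Defs "HOL-Complex_Analysis.Cauchy_Integral_Formula"
begin

text \<open>
  The first inequality is an Ahlfors--Schwarz lemma for the conformal density
  \<open>\<sigma> = \<kappa> |f\<^sub>z| / (1 - |f|\<^sup>2)\<close>, where \<open>\<kappa> = 2 / (K + 1)\<close> is chosen so that quasiregularity reads
  \<open>\<kappa> |f\<^sub>z| \<le> |f\<^sub>z| - |f\<^sub>z\<^sub>b\<^sub>a\<^sub>r|\<close>. For harmonic \<open>f\<close> both \<open>p = f\<^sub>z\<close> and \<open>r\<close>, the conjugate of the other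
  Wirtinger derivative, are holomorphic (\<open>harmonic_on_imp_holomorphic\<close>), and \<open>p\<close> has no zeros because
  the Jacobian is positive. Hence \<open>ln |p|\<close> is harmonic, and a direct computation shows
  \<open>\<Delta> (ln \<sigma>) \<ge> 4 (|p| - |r|)\<^sup>2 / (1 - |f|\<^sup>2)\<^sup>2 \<ge> 4 \<sigma>\<^sup>2\<close>: the metric \<open>\<sigma> |dz|\<close> has curvature at most \<open>-4\<close>.
  The hyperbolic density \<open>\<lambda> = \<rho> / (\<rho>\<^sup>2 - |z|\<^sup>2)\<close> of the disk of radius \<open>\<rho> < 1\<close> satisfies
  \<open>\<Delta> (ln \<lambda>) = 4 \<lambda>\<^sup>2\<close> and is infinite on the boundary, so \<open>ln (\<sigma> / \<lambda>)\<close> has an interior maximum. There its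
  Laplacian is nonpositive, which gives \<open>\<sigma> \<le> \<lambda>\<close> at that point and therefore everywhere. Letting
  \<open>\<rho>\<close> tend to 1 yields \<open>\<kappa> |p| \<le> (1 - |f|\<^sup>2) / (1 - |z|\<^sup>2)\<close> (\<open>ahlfors_schwarz\<close>), and
  \<open>|p| + |r| \<le> K \<kappa> |p|\<close>, again by quasiregularity.

  The second inequality is the one-variable estimate \<open>1 - a\<^sup>2 \<le> (4 / \<pi>) cos (\<pi> a / 2)\<close> on the unit
  interval, and for \<open>K = 1\<close> the identity mapping attains equality in the first one at the origin.
\<close>

section \<open>Symmetry of second derivatives\<close>

lemma has_derivative_along_line:
  assumes "(f has_derivative D) (at (z + s *\<^sub>R a))"
  shows "((\<lambda>t. f (z + t *\<^sub>R a)) has_vector_derivative D a) (at s)"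
proof -
  interpret D: bounded_linear D
    using assms by (rule has_derivative_bounded_linear)
  have "((\<lambda>t. z + t *\<^sub>R a) has_derivative (\<lambda>t. t *\<^sub>R a)) (at s)"
    by (auto intro!: derivative_eq_intros)
  from has_derivative_compose[OF this assms] show ?thesis
    by (simp add: has_vector_derivative_def D.scaleR)
qed

text \<open>
  The mean value theorem, applied once in each direction, evaluates a second-order difference as a
  mixed derivative. The left-hand side is symmetric in \<open>a\<close> and \<open>b\<close>, the right-hand side
  differentiates first along \<open>a\<close>.
\<close>

lemma double_difference_mean_value:
  fixes u :: "'a::real_normed_vector \<Rightarrow> real"
  assumes U: "\<And>z. z \<in> S \<Longrightarrow> (u has_derivative U z) (at z)"
    and A: "\<And>z. z \<in> S \<Longrightarrow> ((\<lambda>z. U z a) has_derivative A z) (at z)"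
    and h: "0 < h"
    and S: "\<And>s t. \<lbrakk>0 \<le> s; s \<le> h; 0 \<le> t; t \<le> h\<rbrakk> \<Longrightarrow> x + s *\<^sub>R a + t *\<^sub>R b \<in> S"
  obtains s t where "0 < s" "s < h" "0 < t" "t < h"
    "u (x + h *\<^sub>R a + h *\<^sub>R b) - u (x + h *\<^sub>R a) - u (x + h *\<^sub>R b) + u x
       = h\<^sup>2 * A (x + s *\<^sub>R a + t *\<^sub>R b) b"
proof -
  have du: "((\<lambda>s. u (x + t *\<^sub>R b + s *\<^sub>R a)) has_real_derivative U (x + s *\<^sub>R a + t *\<^sub>R b) a) (at s)"
    if "0 \<le> s" "s \<le> h" "0 \<le> t" "t \<le> h" for s t
    using has_derivative_along_line[of u "U (x + s *\<^sub>R a + t *\<^sub>R b)" "x + t *\<^sub>R b" s a]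
      U[OF S[OF that]]
    by (simp add: has_real_derivative_iff_has_vector_derivative algebra_simps)
  have dA: "((\<lambda>t. U (x + s *\<^sub>R a + t *\<^sub>R b) a) has_real_derivative A (x + s *\<^sub>R a + t *\<^sub>R b) b) (at t)"
    if "0 \<le> s" "s \<le> h" "0 \<le> t" "t \<le> h" for s t
    using has_derivative_along_line[OF A[OF S[OF that]]]
    by (simp add: has_real_derivative_iff_has_vector_derivative)
  define \<phi> where "\<phi> = (\<lambda>s. u (x + h *\<^sub>R b + s *\<^sub>R a) - u (x + s *\<^sub>R a))"
  have d\<phi>: "(\<phi> has_real_derivative U (x + s *\<^sub>R a + h *\<^sub>R b) a - U (x + s *\<^sub>R a) a) (at s)"
    if "0 \<le> s" "s \<le> h" for s
    unfolding \<phi>_def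
    using DERIV_diff[OF du[OF that, of h] du[OF that, of 0]] h by simp
  obtain s where s: "0 < s" "s < h"
    and s_eq: "\<phi> h - \<phi> 0 = h * (U (x + s *\<^sub>R a + h *\<^sub>R b) a - U (x + s *\<^sub>R a) a)"
    using MVT2[OF h d\<phi>] by auto
  obtain t where t: "0 < t" "t < h"
    and t_eq: "U (x + s *\<^sub>R a + h *\<^sub>R b) a - U (x + s *\<^sub>R a) a = h * A (x + s *\<^sub>R a + t *\<^sub>R b) b"
    using MVT2[OF h dA[of s]] s by auto
  show thesis
    using s t s_eq t_eq
    by (intro that[of s t]) (auto simp: \<phi>_def power2_eq_square algebra_simps)
qed

text \<open>
  The double difference over a small parallelogram at \<open>x\<close> equals \<open>h\<^sup>2\<close> times either mixed derivative
  at some nearby point; by continuity the two mixed derivatives agree at \<open>x\<close>. The mean value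
  theorem needs real values, so vector-valued maps are tested against the difference of
  the two mixed derivatives itself.
\<close>

lemma symmetric_second_derivative:
  fixes f :: "'a::real_normed_vector \<Rightarrow> 'b::real_inner"
  assumes S: "open S" "x \<in> S"
    and F: "\<And>z. z \<in> S \<Longrightarrow> (f has_derivative F z) (at z)"
    and A: "\<And>z. z \<in> S \<Longrightarrow> ((\<lambda>z. F z a) has_derivative A z) (at z)"
    and B: "\<And>z. z \<in> S \<Longrightarrow> ((\<lambda>z. F z b) has_derivative B z) (at z)"
    and contA: "isCont (\<lambda>z. A z b) x"
    and contB: "isCont (\<lambda>z. B z a) x"
  shows "A x b = B x a"
proof (rule ccontr)
  assume ne: "A x b \<noteq> B x a"
  define c where "c = A x b - B x a"
  define \<epsilon> where "\<epsilon> = c \<bullet> c"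
  have \<epsilon>: "\<epsilon> > 0" using ne by (simp add: \<epsilon>_def c_def)
  have "isCont (\<lambda>z. A z b \<bullet> c) x" "isCont (\<lambda>z. B z a \<bullet> c) x"
    using contA contB by (auto intro!: continuous_intros)
  then obtain d1 d2 where d1: "d1 > 0" "\<And>y. dist y x < d1 \<Longrightarrow> \<bar>A y b \<bullet> c - A x b \<bullet> c\<bar> < \<epsilon> / 2"
    and d2: "d2 > 0" "\<And>y. dist y x < d2 \<Longrightarrow> \<bar>B y a \<bullet> c - B x a \<bullet> c\<bar> < \<epsilon> / 2"
    using \<epsilon> unfolding continuous_at_eps_delta dist_real_def by (metis half_gt_zero)
  obtain d3 where d3: "d3 > 0" "ball x d3 \<subseteq> S"
    using S open_contains_ball by blast
  define d where "d = min d1 (min d2 d3)"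
  \<comment> \<open>The summand 1 covers the case that both directions vanish.\<close>
  define h where "h = d / (norm a + norm b + 1)"
  have d0: "d > 0" using d1 d2 d3 by (simp add: d_def)
  have N: "norm a + norm b + 1 > 0" by (simp add: add_nonneg_pos)
  have h: "h > 0" using d0 N by (simp add: h_def)
  have near: "dist (x + s *\<^sub>R a + t *\<^sub>R b) x < d"
    if "0 \<le> s" "s \<le> h" "0 \<le> t" "t \<le> h" for s t
  proof -
    have "dist (x + s *\<^sub>R a + t *\<^sub>R b) x = norm (s *\<^sub>R a + t *\<^sub>R b)"
      by (simp add: dist_norm algebra_simps)
    also have "\<dots> \<le> s * norm a + t * norm b"
      using norm_triangle_ineq[of "s *\<^sub>R a" "t *\<^sub>R b"] that by simp
    also have "\<dots> \<le> h * norm a + h * norm b"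
      using that by (intro add_mono mult_right_mono) auto
    also have "\<dots> < h * (norm a + norm b + 1)"
      using h by (simp add: algebra_simps)
    also have "\<dots> = d" using N by (simp add: h_def)
    finally show ?thesis .
  qed
  have inS: "x + s *\<^sub>R a + t *\<^sub>R b \<in> S" if "0 \<le> s" "s \<le> h" "0 \<le> t" "t \<le> h" for s t
    using near[OF that] d3 by (auto simp: d_def dist_commute)
  have inS': "x + s *\<^sub>R b + t *\<^sub>R a \<in> S" if "0 \<le> s" "s \<le> h" "0 \<le> t" "t \<le> h" for s t
    using inS[of t s] that by (simp add: algebra_simps)
  have F': "((\<lambda>z. f z \<bullet> c) has_derivative (\<lambda>v. F z v \<bullet> c)) (at z)" if "z \<in> S" for z
    using F[OF that] by (rule has_derivative_inner_left)
  have A': "((\<lambda>z. F z a \<bullet> c) has_derivative (\<lambda>v. A z v \<bullet> c)) (at z)" if "z \<in> S" for z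
    using A[OF that] by (rule has_derivative_inner_left)
  have B': "((\<lambda>z. F z b \<bullet> c) has_derivative (\<lambda>v. B z v \<bullet> c)) (at z)" if "z \<in> S" for z
    using B[OF that] by (rule has_derivative_inner_left)
  define \<Delta> where "\<Delta> = f (x + h *\<^sub>R a + h *\<^sub>R b) \<bullet> c - f (x + h *\<^sub>R a) \<bullet> c - f (x + h *\<^sub>R b) \<bullet> c + f x \<bullet> c"
  obtain s t where st: "0 < s" "s < h" "0 < t" "t < h"
    and st_eq: "\<Delta> = h\<^sup>2 * (A (x + s *\<^sub>R a + t *\<^sub>R b) b \<bullet> c)"
    using double_difference_mean_value[where u = "\<lambda>z. f z \<bullet> c" and U = "\<lambda>z v. F z v \<bullet> c"
        and A = "\<lambda>z v. A z v \<bullet> c", OF F' A' h inS]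
    unfolding \<Delta>_def by blast
  obtain s' t' where st': "0 < s'" "s' < h" "0 < t'" "t' < h"
    and st'_eq: "\<Delta> = h\<^sup>2 * (B (x + s' *\<^sub>R b + t' *\<^sub>R a) a \<bullet> c)"
    using double_difference_mean_value[where u = "\<lambda>z. f z \<bullet> c" and U = "\<lambda>z v. F z v \<bullet> c"
        and A = "\<lambda>z v. B z v \<bullet> c", OF F' B' h inS']
    unfolding \<Delta>_def by (simp add: algebra_simps) blast
  have "A (x + s *\<^sub>R a + t *\<^sub>R b) b \<bullet> c = B (x + s' *\<^sub>R b + t' *\<^sub>R a) a \<bullet> c"
    using st_eq st'_eq h by simp
  moreover have "\<bar>A (x + s *\<^sub>R a + t *\<^sub>R b) b \<bullet> c - A x b \<bullet> c\<bar> < \<epsilon> / 2"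
    using near[of s t] st by (intro d1) (auto simp: d_def)
  moreover have "\<bar>B (x + s' *\<^sub>R b + t' *\<^sub>R a) a \<bullet> c - B x a \<bullet> c\<bar> < \<epsilon> / 2"
    using near[of t' s'] st' by (intro d2) (auto simp: d_def algebra_simps)
  moreover have "A x b \<bullet> c - B x a \<bullet> c = \<epsilon>"
    by (simp add: \<epsilon>_def c_def inner_diff_left)
  ultimately show False by linarith
qed

section \<open>Wirtinger derivatives of harmonic mappings\<close>

lemma has_derivative_wirtinger:
  assumes "f differentiable (at z)"
  shows "(f has_derivative (\<lambda>h. wirtinger_z f z * h + wirtinger_zbar f z * cnj h)) (at z)"
proof -
  define D where "D = frechet_derivative f (at z)"
  have D: "(f has_derivative D) (at z)"
    using assms by (simp add: D_def frechet_derivative_works)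
  then interpret bounded_linear D by (rule has_derivative_bounded_linear)
  have "D h = wirtinger_z f z * h + wirtinger_zbar f z * cnj h" for h
  proof -
    have "D h = D (Re h *\<^sub>R 1 + Im h *\<^sub>R \<i>)"
      by (rule arg_cong[of _ _ D]) (simp add: complex_eq_iff)
    also have "\<dots> = Re h *\<^sub>R partial_x f z + Im h *\<^sub>R partial_y f z"
      by (simp only: add scaleR) (simp add: partial_x_def partial_y_def D_def)
    also have "\<dots> = wirtinger_z f z * h + wirtinger_zbar f z * cnj h"
      by (simp add: wirtinger_z_def wirtinger_zbar_def complex_eq_iff field_simps)
    finally show ?thesis .
  qed
  then have "D = (\<lambda>h. wirtinger_z f z * h + wirtinger_zbar f z * cnj h)" ..
  with D show ?thesis by simp
qed

lemma field_derivative_if_cauchy_riemann: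
  assumes D: "(p has_derivative D) (at z)" and CR: "D \<i> = \<i> * D 1"
  shows "(p has_field_derivative D 1) (at z)"
proof -
  interpret bounded_linear D using D by (rule has_derivative_bounded_linear)
  have "D h = D 1 * h" for h
  proof -
    have "D h = D (Re h *\<^sub>R 1 + Im h *\<^sub>R \<i>)"
      by (rule arg_cong[of _ _ D]) (simp add: complex_eq_iff)
    also have "\<dots> = Re h *\<^sub>R D 1 + Im h *\<^sub>R D \<i>"
      by (simp only: add scaleR)
    also have "\<dots> = D 1 * h"
      by (simp add: CR complex_eq_iff algebra_simps)
    finally show ?thesis .
  qed
  then have "D = (*) (D 1)" ..
  with D show ?thesis by (simp add: has_field_derivative_def)
qed

text \<open>
  The Cauchy--Riemann equations for these two functions are Laplace's equation for \<open>f\<close>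
  together with equality of its mixed partial derivatives.
\<close>

lemma harmonic_on_imp_holomorphic:
  assumes "harmonic_on S f"
  shows "wirtinger_z f holomorphic_on S" "(\<lambda>z. cnj (wirtinger_zbar f z)) holomorphic_on S"
proof -
  have S: "open S" and C2: "C2_on S f"
    and lap: "\<And>z. z \<in> S \<Longrightarrow> partial_x (partial_x f) z + partial_y (partial_y f) z = 0"
    using assms by (auto simp: harmonic_on_def)
  have diff: "f differentiable_on S" "partial_x f differentiable_on S" "partial_y f differentiable_on S"
    using C2 by (auto simp: C2_on_def C1_on_def)
  have FD: "(g has_derivative frechet_derivative g (at z)) (at z)"
    if "g differentiable_on S" "z \<in> S" for g :: "complex \<Rightarrow> complex" and z
    using that S differentiable_on_eq_differentiable_at frechet_derivative_works by blast
  define X where "X = (\<lambda>z. frechet_derivative (partial_x f) (at z))"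
  define Y where "Y = (\<lambda>z. frechet_derivative (partial_y f) (at z))"
  have X: "(partial_x f has_derivative X z) (at z)" and Y: "(partial_y f has_derivative Y z) (at z)"
    if "z \<in> S" for z
    using FD diff that by (auto simp: X_def Y_def)
  have cont: "isCont (\<lambda>z. X z \<i>) z" "isCont (\<lambda>z. Y z 1) z" if "z \<in> S" for z
    using C2 that S
    by (auto simp: C2_on_def C1_on_def X_def Y_def continuous_on_eq_continuous_at
        simp flip: partial_x_def partial_y_def)
  have mixed: "X z \<i> = Y z 1" if "z \<in> S" for z
  proof (rule symmetric_second_derivative[OF S that, where F = "\<lambda>z. frechet_derivative f (at z)"
        and A = X and B = Y])
    show "(f has_derivative frechet_derivative f (at z)) (at z)" if "z \<in> S" for z
      using FD diff that by blast
    show "((\<lambda>z. frechet_derivative f (at z) 1) has_derivative X z) (at z)" if "z \<in> S" for z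
      using X[OF that] by (simp add: partial_x_def[abs_def])
    show "((\<lambda>z. frechet_derivative f (at z) \<i>) has_derivative Y z) (at z)" if "z \<in> S" for z
      using Y[OF that] by (simp add: partial_y_def[abs_def])
  qed (use cont that in auto)
  have lap': "Y z \<i> = - X z 1" if "z \<in> S" for z
    using lap[OF that] by (simp add: X_def Y_def partial_x_def partial_y_def eq_neg_iff_add_eq_0 add.commute)
  have "(wirtinger_z f has_field_derivative (X z 1 - \<i> * Y z 1) / 2) (at z)" if "z \<in> S" for z
  proof (rule field_derivative_if_cauchy_riemann)
    show "(wirtinger_z f has_derivative (\<lambda>h. (X z h - \<i> * Y z h) / 2)) (at z)"
      unfolding wirtinger_z_def[abs_def]
      by (auto intro!: derivative_eq_intros X[OF that] Y[OF that])
  qed (simp add: mixed[OF that] lap'[OF that] algebra_simps)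
  moreover have "((\<lambda>z. cnj (wirtinger_zbar f z)) has_field_derivative cnj ((X z 1 + \<i> * Y z 1) / 2)) (at z)"
    if "z \<in> S" for z
  proof (rule field_derivative_if_cauchy_riemann)
    show "((\<lambda>z. cnj (wirtinger_zbar f z)) has_derivative (\<lambda>h. cnj ((X z h + \<i> * Y z h) / 2))) (at z)"
      unfolding wirtinger_zbar_def[abs_def]
      by (intro has_derivative_cnj) (auto intro!: derivative_eq_intros X[OF that] Y[OF that])
  qed (simp add: mixed[OF that] lap'[OF that] algebra_simps)
  ultimately show "wirtinger_z f holomorphic_on S" "(\<lambda>z. cnj (wirtinger_zbar f z)) holomorphic_on S"
    by (auto simp: holomorphic_on_open[OF S])
qed

section \<open>An Ahlfors--Schwarz argument\<close>

lemma second_derivative_nonpos_at_local_max: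
  fixes \<phi> :: "real \<Rightarrow> real"
  assumes d: "d > 0"
    and deriv: "\<And>t. \<bar>t\<bar> < d \<Longrightarrow> (\<phi> has_real_derivative \<phi>' t) (at t)"
    and deriv2: "(\<phi>' has_real_derivative D) (at 0)"
    and max: "\<And>t. \<bar>t\<bar> < d \<Longrightarrow> \<phi> t \<le> \<phi> 0"
  shows "D \<le> 0"
proof (rule ccontr)
  assume "\<not> D \<le> 0"
  have "\<phi>' 0 = 0"
    using DERIV_local_max[of \<phi> "\<phi>' 0" 0 d] d deriv[of 0] max by auto
  with DERIV_pos_inc_right[OF deriv2] \<open>\<not> D \<le> 0\<close>
  obtain \<delta> where \<delta>: "\<delta> > 0" "\<And>h. 0 < h \<Longrightarrow> h < \<delta> \<Longrightarrow> 0 < \<phi>' h"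
    by auto
  define t where "t = min \<delta> d / 2"
  have t: "0 < t" "t < \<delta>" "t < d" using \<delta> d by (auto simp: t_def)
  obtain s where s: "0 < s" "s < t" "\<phi> t - \<phi> 0 = t * \<phi>' s"
    using MVT2[OF t(1), of \<phi> \<phi>'] deriv t by fastforce
  then have "\<phi> t > \<phi> 0"
    using \<delta>(2)[of s] t by (smt (verit) mult_pos_pos)
  with max[of t] t show False by simp
qed

lemma has_real_derivative_inner:
  fixes a b :: "real \<Rightarrow> 'a::real_inner"
  assumes "(a has_vector_derivative a') (at t)" "(b has_vector_derivative b') (at t)"
  shows "((\<lambda>t. a t \<bullet> b t) has_real_derivative a' \<bullet> b t + a t \<bullet> b') (at t)"
  using has_derivative_inner[OF assms[unfolded has_vector_derivative_def]]
  by (auto simp: has_field_derivative_def fun_eq_iff algebra_simps elim!: has_derivative_eq_rhs)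

text \<open>
  The second derivative test along the line \<open>z + t e\<close>, at a maximum \<open>z\<close> of \<open>ln (\<sigma> / \<lambda>)\<close>. Here
  \<open>g\<close> plays the part of \<open>log p\<close>, so that \<open>ln |p| = Re g\<close> and its contribution \<open>Re (g'' e\<^sup>2)\<close>, like all
  terms linear in \<open>e\<^sup>2\<close>, will cancel between \<open>e = 1\<close> and \<open>e = \<i>\<close>. The derivative of \<open>f\<close> along the
  line is \<open>F e\<close>.
\<close>

lemma log_density_second_derivative_test:
  fixes f p r g :: "complex \<Rightarrow> complex"
  assumes S: "open S" "z \<in> S"
    and f: "\<And>z. z \<in> S \<Longrightarrow> (f has_derivative (\<lambda>h. p z * h + cnj (r z * h))) (at z)"
    and p: "(p has_field_derivative p') (at z)"
    and r: "(r has_field_derivative r') (at z)"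
    and g: "\<And>z. z \<in> S \<Longrightarrow> (g has_field_derivative G z) (at z)"
    and G: "(G has_field_derivative G') (at z)"
    and f1: "\<And>z. z \<in> S \<Longrightarrow> norm (f z) < 1"
    and \<rho>: "\<And>z. z \<in> S \<Longrightarrow> (norm z)\<^sup>2 < \<rho>\<^sup>2"
    and max: "\<And>y. y \<in> S \<Longrightarrow>
      Re (g y) - ln (1 - (norm (f y))\<^sup>2) + ln (\<rho>\<^sup>2 - (norm y)\<^sup>2) \<le>
      Re (g z) - ln (1 - (norm (f z))\<^sup>2) + ln (\<rho>\<^sup>2 - (norm z)\<^sup>2)"
  defines "F \<equiv> \<lambda>e. p z * e + cnj (r z * e)"
  shows "Re (G' * e\<^sup>2)
    + 2 * ((norm (F e))\<^sup>2 + f z \<bullet> (p' * e\<^sup>2 + cnj (r' * e\<^sup>2))) / (1 - (norm (f z))\<^sup>2)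
    + 4 * (f z \<bullet> F e)\<^sup>2 / (1 - (norm (f z))\<^sup>2)\<^sup>2
    \<le> 2 * (norm e)\<^sup>2 / (\<rho>\<^sup>2 - (norm z)\<^sup>2) + 4 * (z \<bullet> e)\<^sup>2 / (\<rho>\<^sup>2 - (norm z)\<^sup>2)\<^sup>2"
proof -
  define l where "l = (\<lambda>t::real. z + t *\<^sub>R e)"
  have l0: "l 0 = z" by (simp add: l_def)
  have "continuous_on UNIV l" by (auto simp: l_def intro!: continuous_intros)
  then have "open (l -` S)" using S(1) open_vimage by blast
  moreover have "0 \<in> l -` S" using S by (simp add: l0)
  ultimately obtain d where d: "d > 0" "ball 0 d \<subseteq> l -` S"
    using open_contains_ball by blast
  have lS: "l t \<in> S" if "\<bar>t\<bar> < d" for t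
    using d that by (auto simp: subset_iff)
  \<comment> \<open>Squared norms are written as inner products, which are bilinear and hence easy to differentiate.\<close>
  define \<phi> where "\<phi> = (\<lambda>t. Re (g (l t)) - ln (1 - f (l t) \<bullet> f (l t)) + ln (\<rho>\<^sup>2 - l t \<bullet> l t))"
  define H where "H = (\<lambda>t. p (l t) * e + cnj (r (l t) * e))"
  define \<phi>' where "\<phi>' = (\<lambda>t. Re (G (l t) * e) + 2 * (f (l t) \<bullet> H t) / (1 - f (l t) \<bullet> f (l t))
      - 2 * (l t \<bullet> e) / (\<rho>\<^sup>2 - l t \<bullet> l t))"
  have dl: "(l has_vector_derivative e) (at t)" for t
    by (auto simp: l_def intro!: derivative_eq_intros)
  have fl: "((\<lambda>t. f (l t)) has_vector_derivative H t) (at t)" if "l t \<in> S" for t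
    using has_derivative_along_line[OF f[OF that, unfolded l_def]] by (simp add: l_def H_def)
  have gl: "((\<lambda>t. q (l t)) has_vector_derivative q' * e) (at t)"
    if "(q has_field_derivative q') (at (l t))" for q q' t
    using has_derivative_along_line[of q "(*) q'" z t e] that
    by (simp add: l_def has_field_derivative_def)
  have d\<phi>: "(\<phi> has_real_derivative \<phi>' t) (at t)" if "\<bar>t\<bar> < d" for t
  proof -
    have S': "l t \<in> S" using lS that .
    have "1 - f (l t) \<bullet> f (l t) > 0" "\<rho>\<^sup>2 - l t \<bullet> l t > 0"
      using f1[OF S'] \<rho>[OF S'] by (auto simp: dot_square_norm abs_square_less_1)
    moreover have "((\<lambda>t. Re (g (l t))) has_real_derivative Re (G (l t) * e)) (at t)"
      using bounded_linear.has_vector_derivative[OF bounded_linear_Re gl[OF g[OF S']]]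
      by (simp add: has_real_derivative_iff_has_vector_derivative)
    moreover have "((\<lambda>t. f (l t) \<bullet> f (l t)) has_real_derivative 2 * (f (l t) \<bullet> H t)) (at t)"
      using has_real_derivative_inner[OF fl[OF S'] fl[OF S']] by (simp add: inner_commute)
    moreover have "((\<lambda>t. l t \<bullet> l t) has_real_derivative 2 * (l t \<bullet> e)) (at t)"
      using has_real_derivative_inner[OF dl dl] by (simp add: inner_commute)
    ultimately have "(\<phi> has_real_derivative Re (G (l t) * e)
        - inverse (1 - f (l t) \<bullet> f (l t)) * (0 - 2 * (f (l t) \<bullet> H t))
        + inverse (\<rho>\<^sup>2 - l t \<bullet> l t) * (0 - 2 * (l t \<bullet> e))) (at t)"
      unfolding \<phi>_def
      by (intro DERIV_add DERIV_diff DERIV_chain2[where f = ln] DERIV_ln DERIV_const)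
    then show ?thesis
      by (simp add: \<phi>'_def divide_inverse mult_ac)
  qed
  define D where "D = Re (G' * e\<^sup>2)
    + 2 * ((norm (F e))\<^sup>2 + f z \<bullet> (p' * e\<^sup>2 + cnj (r' * e\<^sup>2))) / (1 - (norm (f z))\<^sup>2)
    + 4 * (f z \<bullet> F e)\<^sup>2 / (1 - (norm (f z))\<^sup>2)\<^sup>2
    - (2 * (norm e)\<^sup>2 / (\<rho>\<^sup>2 - (norm z)\<^sup>2) + 4 * (z \<bullet> e)\<^sup>2 / (\<rho>\<^sup>2 - (norm z)\<^sup>2)\<^sup>2)"
  have d2: "(\<phi>' has_real_derivative D) (at 0)"
  proof -
    have H0: "H 0 = F e" by (simp add: H_def F_def l0)
    have pos: "1 - f (l 0) \<bullet> f (l 0) > 0" "\<rho>\<^sup>2 - l 0 \<bullet> l 0 > 0"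
      using f1[OF S(2)] \<rho>[OF S(2)] by (auto simp: dot_square_norm abs_square_less_1 l0)
    have dH: "(H has_vector_derivative p' * e * e + cnj (r' * e * e)) (at 0)"
      unfolding H_def
      by (intro derivative_intros bounded_linear.has_vector_derivative[OF bounded_linear_cnj]
          bounded_linear.has_vector_derivative[OF bounded_linear_mult_left] gl) (use p r l0 in auto)
    have f0: "((\<lambda>t. f (l t)) has_vector_derivative F e) (at 0)"
      using fl[of 0] S by (simp add: l0 H0)
    have "((\<lambda>t. Re (G (l t) * e)) has_real_derivative Re (G' * e * e)) (at 0)"
      using bounded_linear.has_vector_derivative[OF bounded_linear_Re
          bounded_linear.has_vector_derivative[OF bounded_linear_mult_left gl[of G G' 0]]] G
      by (simp add: has_real_derivative_iff_has_vector_derivative l0)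
    moreover have "((\<lambda>t. f (l t) \<bullet> f (l t)) has_real_derivative 2 * (f z \<bullet> F e)) (at 0)"
      using has_real_derivative_inner[OF f0 f0] by (simp add: inner_commute l0)
    moreover have "((\<lambda>t. f (l t) \<bullet> H t) has_real_derivative
        F e \<bullet> F e + f z \<bullet> (p' * e * e + cnj (r' * e * e))) (at 0)"
      using has_real_derivative_inner[OF f0 dH] by (simp add: l0 H0)
    moreover have "((\<lambda>t. l t \<bullet> l t) has_real_derivative 2 * (z \<bullet> e)) (at 0)"
      using has_real_derivative_inner[OF dl[of 0] dl[of 0]] by (simp add: inner_commute l0)
    moreover have "((\<lambda>t. l t \<bullet> e) has_real_derivative e \<bullet> e) (at 0)"
      using has_real_derivative_inner[OF dl[of 0] has_vector_derivative_const[of e]] by simp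
    ultimately have "(\<phi>' has_real_derivative Re (G' * e * e)
        + ((2 * (F e \<bullet> F e + f z \<bullet> (p' * e * e + cnj (r' * e * e)))) * (1 - f (l 0) \<bullet> f (l 0))
            - (2 * (f (l 0) \<bullet> H 0)) * (- (2 * (f z \<bullet> F e)))) / ((1 - f (l 0) \<bullet> f (l 0)) * (1 - f (l 0) \<bullet> f (l 0)))
        - (2 * (e \<bullet> e) * (\<rho>\<^sup>2 - l 0 \<bullet> l 0)
            - 2 * (l 0 \<bullet> e) * (- (2 * (z \<bullet> e)))) / ((\<rho>\<^sup>2 - l 0 \<bullet> l 0) * (\<rho>\<^sup>2 - l 0 \<bullet> l 0))) (at 0)"
      unfolding \<phi>'_def using pos
      by (intro DERIV_add DERIV_diff DERIV_divide DERIV_cmult) (auto intro!: derivative_eq_intros)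
    also have "(Re (G' * e * e)
        + ((2 * (F e \<bullet> F e + f z \<bullet> (p' * e * e + cnj (r' * e * e)))) * (1 - f (l 0) \<bullet> f (l 0))
            - (2 * (f (l 0) \<bullet> H 0)) * (- (2 * (f z \<bullet> F e)))) / ((1 - f (l 0) \<bullet> f (l 0)) * (1 - f (l 0) \<bullet> f (l 0)))
        - (2 * (e \<bullet> e) * (\<rho>\<^sup>2 - l 0 \<bullet> l 0)
            - 2 * (l 0 \<bullet> e) * (- (2 * (z \<bullet> e)))) / ((\<rho>\<^sup>2 - l 0 \<bullet> l 0) * (\<rho>\<^sup>2 - l 0 \<bullet> l 0))) = D"
    proof -
      have quot: "(2 * A * c - 2 * B * - (2 * B)) / (c * c) = 2 * A / c + 4 * B\<^sup>2 / c\<^sup>2"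
        if "c > 0" for A B c :: real
        using that by (simp add: field_simps power2_eq_square)
      show ?thesis
        unfolding l0 H0 quot[OF pos(1)[unfolded l0]] quot[OF pos(2)[unfolded l0]]
        by (simp add: D_def power2_eq_square mult.assoc flip: power2_norm_eq_inner)
    qed
    finally show ?thesis .
  qed
  have "D \<le> 0"
  proof (rule second_derivative_nonpos_at_local_max[OF d(1) d\<phi> d2])
    show "\<phi> t \<le> \<phi> 0" if "\<bar>t\<bar> < d" for t
      using max[OF lS[OF that]] by (simp add: \<phi>_def l0 power2_norm_eq_inner)
  qed
  then show ?thesis by (simp add: D_def)
qed

text \<open>
  Adding the second derivative tests for \<open>e = 1\<close> and \<open>e = \<i>\<close> compares the Laplacians of
  \<open>ln \<sigma>\<close> and \<open>ln \<lambda>\<close>. On the side of \<open>\<sigma>\<close> the sum of the squares of the derivatives of \<open>|f|\<^sup>2\<close>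
  is at least \<open>4 |f|\<^sup>2 (|p| - |r|)\<^sup>2\<close>, and \<open>|p|\<^sup>2 + |r|\<^sup>2 \<ge> (|p| - |r|)\<^sup>2\<close>; since \<open>(1 - |f|\<^sup>2) + |f|\<^sup>2 = 1\<close>,
  these two bounds add up to the curvature term \<open>4 (|p| - |r|)\<^sup>2 / (1 - |f|\<^sup>2)\<^sup>2\<close>.
\<close>

lemma log_density_critical_bound:
  fixes f p r g :: "complex \<Rightarrow> complex"
  assumes S: "open S" "z \<in> S"
    and f: "\<And>z. z \<in> S \<Longrightarrow> (f has_derivative (\<lambda>h. p z * h + cnj (r z * h))) (at z)"
    and p: "p holomorphic_on S" and r: "r holomorphic_on S" and g: "g holomorphic_on S"
    and f1: "\<And>z. z \<in> S \<Longrightarrow> norm (f z) < 1"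
    and \<rho>: "\<rho> > 0" "\<And>z. z \<in> S \<Longrightarrow> norm z < \<rho>"
    and max: "\<And>y. y \<in> S \<Longrightarrow>
      Re (g y) - ln (1 - (norm (f y))\<^sup>2) + ln (\<rho>\<^sup>2 - (norm y)\<^sup>2) \<le>
      Re (g z) - ln (1 - (norm (f z))\<^sup>2) + ln (\<rho>\<^sup>2 - (norm z)\<^sup>2)"
  shows "(norm (p z) - norm (r z)) * (\<rho>\<^sup>2 - (norm z)\<^sup>2) \<le> \<rho> * (1 - (norm (f z))\<^sup>2)"
proof -
  define P R where "P = norm (p z)" and "R = norm (r z)"
  define c b w where "c = 1 - (norm (f z))\<^sup>2" and "b = \<rho>\<^sup>2 - (norm z)\<^sup>2" and "w = (norm (f z))\<^sup>2"
  have \<rho>': "(norm y)\<^sup>2 < \<rho>\<^sup>2" if "y \<in> S" for y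
    using \<rho>(2)[OF that] by (simp add: power_strict_mono)
  have c: "c > 0" using f1[OF S(2)] by (simp add: c_def abs_square_less_1)
  have b: "b > 0" using \<rho>'[OF S(2)] by (simp add: b_def)
  define F where "F = (\<lambda>e. p z * e + cnj (r z * e))"
  define p' r' G' where "p' = deriv p z" and "r' = deriv r z" and "G' = deriv (deriv g) z"
  have bound: "Re (G' * e\<^sup>2) + 2 * ((norm (F e))\<^sup>2 + f z \<bullet> (p' * e\<^sup>2 + cnj (r' * e\<^sup>2))) / c
      + 4 * (f z \<bullet> F e)\<^sup>2 / c\<^sup>2 \<le> 2 * (norm e)\<^sup>2 / b + 4 * (z \<bullet> e)\<^sup>2 / b\<^sup>2" for e
    unfolding F_def c_def b_def p'_def r'_def G'_def
  proof (rule log_density_second_derivative_test[OF S f, where g = g and G = "deriv g"])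
    show "(g has_field_derivative deriv g y) (at y)" if "y \<in> S" for y
      using g S that holomorphic_derivI by blast
    show "(deriv g has_field_derivative deriv (deriv g) z) (at z)"
      using g S holomorphic_derivI holomorphic_deriv by blast
  qed (use p r S holomorphic_derivI f1 \<rho>' max in blast)+
  \<comment> \<open>\<open>4 B\<close> is the squared gradient of \<open>|f|\<^sup>2\<close> at \<open>z\<close>.\<close>
  define B where "B = (f z \<bullet> F 1)\<^sup>2 + (f z \<bullet> F \<i>)\<^sup>2"
  have sum: "2 * ((norm (F 1))\<^sup>2 + (norm (F \<i>))\<^sup>2) / c + 4 * ((f z \<bullet> F 1)\<^sup>2 + (f z \<bullet> F \<i>)\<^sup>2) / c\<^sup>2
      \<le> 4 / b + 4 * ((z \<bullet> 1)\<^sup>2 + (z \<bullet> \<i>)\<^sup>2) / b\<^sup>2"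
  proof -
    have "f z \<bullet> (p' * \<i>\<^sup>2 + cnj (r' * \<i>\<^sup>2)) = - (f z \<bullet> (p' * 1\<^sup>2 + cnj (r' * 1\<^sup>2)))"
      by (simp add: inner_complex_def algebra_simps)
    then show ?thesis
      using add_mono[OF bound[of 1] bound[of \<i>]]
      by (simp add: add_divide_distrib diff_divide_distrib distrib_left distrib_right)
  qed
  have FF: "(norm (F 1))\<^sup>2 + (norm (F \<i>))\<^sup>2 = 2 * (P\<^sup>2 + R\<^sup>2)"
    unfolding F_def P_def R_def cmod_power2 by (simp add: power2_eq_square algebra_simps)
  have zz: "(z \<bullet> 1)\<^sup>2 + (z \<bullet> \<i>)\<^sup>2 = (norm z)\<^sup>2"
    unfolding cmod_power2 by (simp add: inner_complex_def)
  \<comment> \<open>\<open>f \<bullet> F 1\<close> and \<open>- (f \<bullet> F \<i>)\<close> are the real and imaginary part of \<open>cnj f * p + f * r\<close>.\<close>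
  have fF: "w * (P - R)\<^sup>2 \<le> B"
  proof -
    have "norm (f z) * \<bar>P - R\<bar> = \<bar>norm (cnj (f z) * p z) - norm (- (f z * r z))\<bar>"
      by (simp add: P_def R_def norm_mult abs_mult flip: right_diff_distrib)
    also have "\<dots> \<le> norm (cnj (f z) * p z + f z * r z)"
      using norm_triangle_ineq3[of "cnj (f z) * p z" "- (f z * r z)"] by simp
    finally have "(norm (f z) * \<bar>P - R\<bar>)\<^sup>2 \<le> (norm (cnj (f z) * p z + f z * r z))\<^sup>2"
      by (rule power_mono) simp
    also have "\<dots> = B"
      unfolding B_def cmod_power2 F_def inner_complex_def by (simp add: power2_eq_square algebra_simps)
    finally show ?thesis by (simp add: power_mult_distrib w_def)
  qed
  have "2 * (2 * (P\<^sup>2 + R\<^sup>2)) / c + 4 * B / c\<^sup>2 \<le> 4 / b + 4 * (norm z)\<^sup>2 / b\<^sup>2"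
    using sum unfolding FF zz B_def .
  moreover have "w * (P - R)\<^sup>2 / c\<^sup>2 \<le> B / c\<^sup>2"
    using fF by (intro divide_right_mono) auto
  moreover have "(P - R)\<^sup>2 / c \<le> (P\<^sup>2 + R\<^sup>2) / c"
    using c by (intro divide_right_mono) (auto simp: P_def R_def power2_diff)
  moreover have "(P - R)\<^sup>2 / c + w * (P - R)\<^sup>2 / c\<^sup>2 = ((P - R) / c)\<^sup>2"
  proof -
    have "(P - R)\<^sup>2 / c + w * (P - R)\<^sup>2 / c\<^sup>2 = (c + w) * (P - R)\<^sup>2 / c\<^sup>2"
      using c by (simp add: field_simps power2_eq_square)
    then show ?thesis by (simp add: c_def w_def power_divide)
  qed
  moreover have "1 / b + (norm z)\<^sup>2 / b\<^sup>2 = (\<rho> / b)\<^sup>2"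
  proof -
    have "1 / b + (norm z)\<^sup>2 / b\<^sup>2 = (b + (norm z)\<^sup>2) / b\<^sup>2"
      using b by (simp add: field_simps power2_eq_square)
    then show ?thesis by (simp add: b_def power_divide)
  qed
  ultimately have "((P - R) / c)\<^sup>2 \<le> (\<rho> / b)\<^sup>2" by linarith
  then have "(P - R) / c \<le> \<rho> / b"
    by (rule power2_le_imp_le) (use \<rho> b in simp)
  then show ?thesis
    using b c by (simp add: field_simps P_def R_def b_def c_def)
qed

text \<open>
  The quotient \<open>Q\<close> is \<open>\<sigma> / \<lambda>\<close> up to a constant factor. It is continuous on the closed disk of radius \<open>\<rho>\<close>, vanishes on its
  boundary and is positive inside, so that it attains its maximum at an interior point; there its
  logarithm satisfies the hypotheses of \<open>log_density_critical_bound\<close>.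
\<close>

lemma ahlfors_schwarz_subdisk:
  fixes f p r :: "complex \<Rightarrow> complex"
  assumes f: "\<And>z. z \<in> ball 0 1 \<Longrightarrow> (f has_derivative (\<lambda>h. p z * h + cnj (r z * h))) (at z)"
    and p: "p holomorphic_on ball 0 1" and r: "r holomorphic_on ball 0 1"
    and p0: "\<And>z. z \<in> ball 0 1 \<Longrightarrow> p z \<noteq> 0"
    and f1: "\<And>z. z \<in> ball 0 1 \<Longrightarrow> norm (f z) < 1"
    and \<kappa>: "\<kappa> \<ge> 0" "\<And>z. z \<in> ball 0 1 \<Longrightarrow> \<kappa> * norm (p z) \<le> norm (p z) - norm (r z)"
    and \<rho>: "0 < \<rho>" "\<rho> < 1" and z: "norm z < \<rho>"
  shows "\<kappa> * norm (p z) * (\<rho>\<^sup>2 - (norm z)\<^sup>2) \<le> \<rho> * (1 - (norm (f z))\<^sup>2)"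
proof -
  define Q where "Q = (\<lambda>z. norm (p z) * (\<rho>\<^sup>2 - (norm z)\<^sup>2) / (1 - (norm (f z))\<^sup>2))"
  have pos: "1 - (norm (f y))\<^sup>2 > 0" if "y \<in> ball 0 1" for y
    using f1[OF that] by (simp add: abs_square_less_1)
  have sub: "cball 0 \<rho> \<subseteq> ball (0::complex) 1" using \<rho> by auto
  have "continuous_on (ball 0 1) f"
    using f has_derivative_continuous continuous_at_imp_continuous_on by blast
  then have "continuous_on (cball 0 \<rho>) Q"
    unfolding Q_def using pos sub
    by (intro continuous_intros continuous_on_subset[OF _ sub] holomorphic_on_imp_continuous_on[OF p])
      (auto simp: subset_iff less_le)
  then obtain m where m: "m \<in> cball 0 \<rho>" "\<And>y. y \<in> cball 0 \<rho> \<Longrightarrow> Q y \<le> Q m"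
    using continuous_attains_sup[of "cball 0 \<rho>" Q] \<rho> by fastforce
  have sq: "(norm y)\<^sup>2 < \<rho>\<^sup>2" if "y \<in> ball 0 \<rho>" for y :: complex
    using that by (simp add: power_strict_mono)
  have Qpos: "Q y > 0" if "y \<in> ball 0 \<rho>" for y
    using sq[OF that] p0[of y] pos[of y] that \<rho> by (auto simp: Q_def)
  have m_in: "m \<in> ball 0 \<rho>"
  proof (rule ccontr)
    assume "m \<notin> ball 0 \<rho>"
    then have "norm m = \<rho>" using m by simp
    then have "Q m = 0" by (simp add: Q_def)
    moreover have "Q m > 0" using m(2)[of z] Qpos[of z] z by auto
    ultimately show False by simp
  qed
  obtain g where g: "g holomorphic_on ball 0 1" "\<And>z. z \<in> ball 0 1 \<Longrightarrow> p z = exp (g z)"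
    using contractible_imp_holomorphic_log[OF p convex_imp_contractible[OF convex_ball]] p0 by blast
  have lnQ: "ln (Q y) = Re (g y) - ln (1 - (norm (f y))\<^sup>2) + ln (\<rho>\<^sup>2 - (norm y)\<^sup>2)"
    if "y \<in> ball 0 \<rho>" for y
  proof -
    have y1: "y \<in> ball 0 1" using that \<rho> by auto
    show ?thesis
      using sq[OF that] pos[OF y1] g(2)[OF y1] p0[OF y1]
      by (simp add: Q_def ln_div ln_mult norm_exp_eq_Re)
  qed
  have "(norm (p m) - norm (r m)) * (\<rho>\<^sup>2 - (norm m)\<^sup>2) \<le> \<rho> * (1 - (norm (f m))\<^sup>2)"
  proof (rule log_density_critical_bound[where S = "ball 0 \<rho>" and g = g])
    show "Re (g y) - ln (1 - (norm (f y))\<^sup>2) + ln (\<rho>\<^sup>2 - (norm y)\<^sup>2) \<le>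
      Re (g m) - ln (1 - (norm (f m))\<^sup>2) + ln (\<rho>\<^sup>2 - (norm m)\<^sup>2)" if "y \<in> ball 0 \<rho>" for y
      using m(2)[of y] Qpos[OF that] that unfolding lnQ[OF that, symmetric] lnQ[OF m_in, symmetric]
      by simp
    show "p holomorphic_on ball 0 \<rho>" "r holomorphic_on ball 0 \<rho>" "g holomorphic_on ball 0 \<rho>"
      using p r g(1) \<rho> by (auto elim!: holomorphic_on_subset)
  qed (use m_in f f1 \<rho> in auto)
  moreover have "\<kappa> * norm (p m) * (\<rho>\<^sup>2 - (norm m)\<^sup>2) \<le> (norm (p m) - norm (r m)) * (\<rho>\<^sup>2 - (norm m)\<^sup>2)"
    using \<kappa>(2)[of m] m_in sq[OF m_in] \<rho> by (intro mult_right_mono) auto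
  ultimately have "\<kappa> * norm (p m) * (\<rho>\<^sup>2 - (norm m)\<^sup>2) \<le> \<rho> * (1 - (norm (f m))\<^sup>2)"
    by linarith
  then have "\<kappa> * Q m \<le> \<rho>"
    using pos[of m] m_in \<rho> by (simp add: Q_def field_simps)
  moreover have "\<kappa> * Q z \<le> \<kappa> * Q m"
    using m(2)[of z] z \<kappa>(1) by (simp add: mult_left_mono)
  ultimately have "\<kappa> * Q z \<le> \<rho>" by linarith
  then show ?thesis
    using pos[of z] z \<rho> by (simp add: Q_def field_simps)
qed

lemma ahlfors_schwarz:
  fixes f p r :: "complex \<Rightarrow> complex"
  assumes f: "\<And>z. z \<in> ball 0 1 \<Longrightarrow> (f has_derivative (\<lambda>h. p z * h + cnj (r z * h))) (at z)"
    and p: "p holomorphic_on ball 0 1" and r: "r holomorphic_on ball 0 1"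
    and p0: "\<And>z. z \<in> ball 0 1 \<Longrightarrow> p z \<noteq> 0"
    and f1: "\<And>z. z \<in> ball 0 1 \<Longrightarrow> norm (f z) < 1"
    and \<kappa>: "\<kappa> \<ge> 0" "\<And>z. z \<in> ball 0 1 \<Longrightarrow> \<kappa> * norm (p z) \<le> norm (p z) - norm (r z)"
    and z: "z \<in> ball 0 1"
  shows "\<kappa> * norm (p z) * (1 - (norm z)\<^sup>2) \<le> 1 - (norm (f z))\<^sup>2"
proof (rule tendsto_le[of "at_left (1::real)"])
  show "((\<lambda>\<rho>. \<rho> * (1 - (norm (f z))\<^sup>2)) \<longlongrightarrow> 1 - (norm (f z))\<^sup>2) (at_left 1)"
    by (auto intro!: tendsto_eq_intros)
  show "((\<lambda>\<rho>. \<kappa> * norm (p z) * (\<rho>\<^sup>2 - (norm z)\<^sup>2)) \<longlongrightarrow> \<kappa> * norm (p z) * (1 - (norm z)\<^sup>2)) (at_left 1)"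
    by (auto intro!: tendsto_eq_intros)
  have "\<forall>\<^sub>F \<rho> in at_left 1. \<rho> \<in> {norm z<..<1}"
    using z by (intro eventually_at_leftI[of "norm z"]) auto
  then show "\<forall>\<^sub>F \<rho> in at_left 1. \<kappa> * norm (p z) * (\<rho>\<^sup>2 - (norm z)\<^sup>2) \<le> \<rho> * (1 - (norm (f z))\<^sup>2)"
  proof eventually_elim
    case (elim \<rho>)
    then have "0 < \<rho>" by (auto intro: le_less_trans[OF norm_ge_zero])
    with elim show ?case
      by (intro ahlfors_schwarz_subdisk[OF f p r p0 f1 \<kappa>]) auto
  qed
qed simp

section \<open>The two inequalities and the extremal mapping\<close>

text \<open>
  With \<open>\<kappa> = 2 / (K + 1)\<close>, the inequality \<open>|p| + |r| \<le> K (|p| - |r|)\<close> is equivalent both to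
  \<open>\<kappa> |p| \<le> |p| - |r|\<close>, the hypothesis of the Ahlfors--Schwarz lemma, and to \<open>|p| + |r| \<le> K \<kappa> |p|\<close>, which converts its
  conclusion into a bound for \<open>\<Lambda>\<^sub>f\<close>.
\<close>

lemma Lambda_max_le:
  assumes f: "quasiregular_harmonic K f" and im: "f ` unit_disk \<subseteq> unit_disk" and z: "z \<in> unit_disk"
  shows "Lambda_max f z \<le> K * ((1 - (norm (f z))\<^sup>2) / (1 - (norm z)\<^sup>2))"
proof -
  define p r where "p = wirtinger_z f" and "r = (\<lambda>z. cnj (wirtinger_zbar f z))"
  have harm: "harmonic_on unit_disk f"
    and jac: "\<And>y. y \<in> unit_disk \<Longrightarrow> jacobian_det f y > 0"
    and K: "\<And>y. y \<in> unit_disk \<Longrightarrow> Lambda_max f y / lambda_min f y \<le> K"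
    using f by (auto simp: quasiregular_harmonic_def sense_preserving_on_def)
  have \<lambda>: "norm (r y) < norm (p y)" if "y \<in> unit_disk" for y
    using jac[OF that] by (auto simp: jacobian_det_def p_def r_def intro: power2_less_imp_less)
  have "K > 0"
  proof -
    have "Lambda_max f z / lambda_min f z > 0"
      using \<lambda>[OF z] norm_ge_zero[of "r z"] 
      by (auto simp: Lambda_max_def lambda_min_def p_def r_def intro!: divide_pos_pos add_pos_nonneg)
    with K[OF z] show ?thesis by linarith
  qed
  have \<Lambda>: "norm (p y) + norm (r y) \<le> K * (norm (p y) - norm (r y))" if "y \<in> unit_disk" for y
    using K[OF that] \<lambda>[OF that]
    by (simp add: Lambda_max_def lambda_min_def p_def r_def pos_divide_le_eq)
  have "2 / (K + 1) * norm (p z) * (1 - (norm z)\<^sup>2) \<le> 1 - (norm (f z))\<^sup>2"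
  proof (rule ahlfors_schwarz[where f = f and r = r])
    show "(f has_derivative (\<lambda>h. p y * h + cnj (r y * h))) (at y)" if "y \<in> unit_disk" for y
      using has_derivative_wirtinger[of f y] harm that
      by (simp add: p_def r_def harmonic_on_def C2_on_def C1_on_def differentiable_on_eq_differentiable_at)
    show "2 / (K + 1) * norm (p y) \<le> norm (p y) - norm (r y)" if "y \<in> unit_disk" for y
      using \<Lambda>[OF that] \<open>K > 0\<close> by (simp add: field_simps)
    show "p y \<noteq> 0" if "y \<in> unit_disk" for y
      using \<lambda>[OF that] by auto
    show "norm (f y) < 1" if "y \<in> unit_disk" for y
      using im that by (auto simp: image_subset_iff)
  qed (use harmonic_on_imp_holomorphic[OF harm] \<open>K > 0\<close> z in \<open>auto simp: p_def r_def\<close>)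
  moreover have "1 - (norm z)\<^sup>2 > 0"
    using z by (simp add: abs_square_less_1)
  ultimately have "2 / (K + 1) * norm (p z) \<le> (1 - (norm (f z))\<^sup>2) / (1 - (norm z)\<^sup>2)"
    by (simp add: pos_le_divide_eq)
  then have "K * (2 / (K + 1) * norm (p z)) \<le> K * ((1 - (norm (f z))\<^sup>2) / (1 - (norm z)\<^sup>2))"
    using \<open>K > 0\<close> by (intro mult_left_mono) auto
  moreover have "norm (p z) + norm (r z) \<le> K * (2 / (K + 1) * norm (p z))"
    using \<Lambda>[OF z] \<open>K > 0\<close> by (simp add: field_simps)
  ultimately show ?thesis by (simp add: Lambda_max_def p_def r_def)
qed

text \<open>
  Both sides vanish at \<open>a = 1\<close>, and the derivative of their difference has a constant sign
  by Jordan's inequality \<open>x \<le> sin (\<pi> x / 2)\<close>, which expresses the concavity of the sine.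
\<close>

lemma one_minus_square_le_cos:
  fixes a :: real
  assumes a: "0 \<le> a" "a \<le> 1"
  shows "1 - a\<^sup>2 \<le> 4 / pi * cos (a * pi / 2)"
proof -
  have sin_ge: "x \<le> sin (x * pi / 2)" if x: "0 \<le> x" "x \<le> 1" for x :: real
  proof -
    have "concave_on {0..pi / 2} sin"
    proof (rule f''_le0_imp_concave[where f' = cos and f'' = "\<lambda>x. - sin x"])
      show "- sin x \<le> 0" if "x \<in> {0..pi / 2}" for x
        using that by (auto intro!: sin_ge_zero)
    qed (auto intro!: derivative_eq_intros)
    from concave_onD[OF this x, of 0 "pi / 2"] show ?thesis by simp
  qed
  define \<phi> where "\<phi> = (\<lambda>x. 4 / pi * cos (x * pi / 2) - (1 - x\<^sup>2))"
  have "\<phi> 1 \<le> \<phi> a"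
  proof (rule DERIV_nonpos_imp_nonincreasing[OF a(2)])
    fix x assume "a \<le> x" "x \<le> 1"
    then have "x \<le> sin (x * pi / 2)" using a by (intro sin_ge) auto
    moreover have "(\<phi> has_real_derivative - 2 * sin (x * pi / 2) + 2 * x) (at x)"
      unfolding \<phi>_def by (auto intro!: derivative_eq_intros simp: field_simps)
    ultimately show "\<exists>D. (\<phi> has_real_derivative D) (at x) \<and> D \<le> 0" by fastforce
  qed
  then show ?thesis by (simp add: \<phi>_def)
qed

lemma wirtinger_ident:
  "wirtinger_z (\<lambda>z. z) = (\<lambda>_. 1)" "wirtinger_zbar (\<lambda>z. z) = (\<lambda>_. 0)"
  by (auto simp: wirtinger_z_def wirtinger_zbar_def partial_x_def partial_y_def)

lemma quasiregular_harmonic_ident: "quasiregular_harmonic 1 (\<lambda>z. z)"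
proof -
  have x: "partial_x (\<lambda>z. z) = (\<lambda>_. 1)" and y: "partial_y (\<lambda>z. z) = (\<lambda>_. \<i>)"
    by (auto simp: partial_x_def partial_y_def)
  have const: "partial_x (\<lambda>_. c) = (\<lambda>_. 0)" "partial_y (\<lambda>_. c) = (\<lambda>_. 0)" for c
    by (auto simp: partial_x_def partial_y_def)
  show ?thesis
    by (simp add: quasiregular_harmonic_def harmonic_on_def C2_on_def C1_on_def x y const
        sense_preserving_on_def jacobian_det_def Lambda_max_def lambda_min_def wirtinger_ident)
qed

theorem lemma1:
  shows "(\<forall>(K::real) (f::complex \<Rightarrow> complex).
            1 \<le> K \<longrightarrow> quasiregular_harmonic K f \<longrightarrow> f ` unit_disk \<subseteq> unit_disk \<longrightarrow>
            (\<forall>z\<in>unit_disk.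
               Lambda_max f z \<le> K * ((1 - (cmod (f z))\<^sup>2) / (1 - (cmod z)\<^sup>2)) \<and>
               K * ((1 - (cmod (f z))\<^sup>2) / (1 - (cmod z)\<^sup>2))
                 \<le> (4 * K / pi) * (cos (cmod (f z) * pi / 2) / (1 - (cmod z)\<^sup>2)))) \<and>
         (\<exists>f::complex \<Rightarrow> complex. quasiregular_harmonic 1 f \<and> f ` unit_disk \<subseteq> unit_disk \<and>
            (\<exists>z\<in>unit_disk.
               Lambda_max f z = 1 * ((1 - (cmod (f z))\<^sup>2) / (1 - (cmod z)\<^sup>2))))"
proof (intro conjI allI impI ballI)
  fix K :: real and f z
  assume K: "1 \<le> K" and f: "quasiregular_harmonic K f" "f ` unit_disk \<subseteq> unit_disk"
    and z: "z \<in> unit_disk"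
  show "Lambda_max f z \<le> K * ((1 - (cmod (f z))\<^sup>2) / (1 - (cmod z)\<^sup>2))"
    using Lambda_max_le[OF f z] .
  have "1 - (cmod z)\<^sup>2 > 0" and "cmod (f z) \<le> 1"
    using z f(2) by (auto simp: abs_square_less_1 image_subset_iff intro: less_imp_le)
  then have "K * ((1 - (cmod (f z))\<^sup>2) / (1 - (cmod z)\<^sup>2))
      \<le> K * ((4 / pi * cos (cmod (f z) * pi / 2)) / (1 - (cmod z)\<^sup>2))"
    using K by (intro mult_left_mono divide_right_mono one_minus_square_le_cos) auto
  then show "K * ((1 - (cmod (f z))\<^sup>2) / (1 - (cmod z)\<^sup>2))
      \<le> (4 * K / pi) * (cos (cmod (f z) * pi / 2) / (1 - (cmod z)\<^sup>2))"
    by (simp add: mult_ac)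
next
  show "\<exists>f. quasiregular_harmonic 1 f \<and> f ` unit_disk \<subseteq> unit_disk \<and>
    (\<exists>z\<in>unit_disk. Lambda_max f z = 1 * ((1 - (cmod (f z))\<^sup>2) / (1 - (cmod z)\<^sup>2)))"
    by (intro exI[of _ "\<lambda>z. z"] conjI bexI[of _ 0])
      (auto simp: quasiregular_harmonic_ident Lambda_max_def wirtinger_ident)
qed

end
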